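(* Let $h=2k$ be a positive even integer, let $\mathcal{A}$ be a $B_h$-set with counting function $A(x)=|\mathcal{A}\cap[0,x)|$, and suppose there are $\tau>0$ and $n_0\ge e$ such that $$A(x)\ge\tau\left(\frac{x}{\log x}\right)^{1/h}\qquad\text{for all real } x>n_0.$$ Let $\mathcal{S}=k\mathcal{A}$ be the $k$-fold sumset of $\mathcal{A}$, with counting function $S(m)=|\mathcal{S}\cap[0,m)|$. Then $$\liminf_{m\to\infty}\frac{S(m)}{\sqrt{m/\log m}}\ge\frac{2\tau^k\,\Gamma(1+\tfrac1h)^k}{k!\sqrt{\pi}}.$$
   Context: A set $\mathcal{A}$ of nonnegative integers is a $B_h$-set if the sums $a_1+\cdots+a_h$ with $a_1\le\cdots\le a_h$ and all $a_i\in\mathcal{A}$ are distinct (i.e., distinct nondecreasing $h$-tuples of elements of $\mathcal{A}$ have distinct sums). The $k$-fold sumset is $k\mathcal{A}=\{a_1+\cdots+a_k : a_1,\dots,a_k\in\mathcal{A}\}$ (repetitions allowed). $e$ is the base of the natural logarithm $\log$, and $\Gamma$ is the Gamma function. *)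

theory Defs
  imports "HOL-Analysis.Analysis"
begin

definition Bh_set :: "nat \<Rightarrow> nat set \<Rightarrow> bool" where
  "Bh_set h A \<longleftrightarrow> inj_on sum_list {as. length as = h \<and> sorted as \<and> set as \<subseteq> A}"

definition sumset_fold :: "nat \<Rightarrow> nat set \<Rightarrow> nat set" where
  "sumset_fold k A = {sum_list as | as. length as = k \<and> set as \<subseteq> A}"

definition counting :: "nat set \<Rightarrow> real \<Rightarrow> nat" where
  "counting A x = card {n \<in> A. real n \<in> {0..<x}}"

end

theory Submission
  imports Defs "HOL-Combinatorics.Multiset_Permutations"
begin

text \<open>
  Let \<open>R j t\<close> be the number of ordered \<open>j\<close>-tuples from \<open>A\<close> with sum below \<open>t\<close>. Two \<open>k\<close>-tuples with
  the same sum are rearrangements of each other, because a \<open>B\<close>-set of order \<open>2 * k\<close> is also one of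
  order \<open>k\<close>; hence the counting function of the \<open>k\<close>-fold sumset at \<open>m\<close> is at least
  \<open>R k m / fact k\<close> (\<open>card_tuples_below_le\<close>), and it suffices to bound \<open>R k m\<close> from below.

  Fix \<open>m\<close> and put \<open>\<alpha> = 1 / h\<close>. For \<open>n0 < u \<le> m\<close> the logarithm of \<open>u\<close> is at most \<open>ln m\<close>, so the
  hypothesis gives a pure power bound: at least \<open>C * (u - n0) powr \<alpha>\<close> elements of \<open>A\<close> lie below
  \<open>u\<close>, where \<open>C = \<tau> / ln m powr \<alpha>\<close>. The shift by \<open>n0\<close> costs nothing in the limit, and it makes an
  exact induction on \<open>j\<close> possible, with no error terms (\<open>card_tuples_below_ge\<close>):
  \<open>R j t \<ge> C ^ j * Gamma (1 + \<alpha>) ^ j / Gamma (1 + j * \<alpha>) * (t - j * n0) powr (j * \<alpha>)\<close> whenever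
  \<open>j * n0 < t \<le> m\<close>. In the induction step, \<open>R (j + 1) t\<close> is the sum of \<open>R j (t - a)\<close> over the
  first entries \<open>a\<close>; the induction hypothesis bounds it by a sum of powers over the elements of \<open>A\<close>,
  and partial summation with the Beta integral bounds that sum from below (\<open>sum_powr_ge\<close>).
  For \<open>j = k\<close> the exponent is \<open>k * \<alpha> = 1 / 2\<close>, and \<open>Gamma (3 / 2) = sqrt pi / 2\<close>;
  dividing by \<open>fact k * sqrt (m / ln m)\<close> leaves the claimed constant times
  \<open>sqrt ((m - k * n0) / m)\<close>, which tends to it.
\<close>

section \<open>Tuples with bounded sum\<close>

text \<open>The ordered \<open>j\<close>-tuples of elements of \<open>A\<close>, repetitions allowed, with sum below \<open>t\<close>.\<close>
definition tuples_below :: "nat set \<Rightarrow> nat \<Rightarrow> real \<Rightarrow> nat list set" where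
  "tuples_below A j t = {xs. length xs = j \<and> set xs \<subseteq> A \<and> real (sum_list xs) < t}"

lemma finite_nat_below: "finite {n \<in> A. real n < t}" for A :: "nat set"
proof (rule finite_subset)
  show "{n \<in> A. real n < t} \<subseteq> {..nat \<lceil>t\<rceil>}"
    by (auto simp: le_nat_iff) linarith
qed auto

lemma counting_eq: "counting A x = card {n \<in> A. real n < x}"
  by (simp add: counting_def)

lemma finite_tuples_below: "finite (tuples_below A j t)"
proof (rule finite_subset)
  show "tuples_below A j t \<subseteq> {xs. set xs \<subseteq> {n \<in> UNIV. real n < t} \<and> length xs = j}"
  proof
    fix xs assume xs: "xs \<in> tuples_below A j t"
    have "real x < t" if "x \<in> set xs" for x
      using member_le_sum_list[OF that] xs by (auto simp: tuples_below_def)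
    with xs show "xs \<in> {xs. set xs \<subseteq> {n \<in> UNIV. real n < t} \<and> length xs = j}"
      by (auto simp: tuples_below_def)
  qed
  show "finite {xs. set xs \<subseteq> {n \<in> UNIV. real n < t} \<and> length xs = j}"
    by (rule finite_lists_length_eq[OF finite_nat_below])
qed

lemma card_tuples_below_1: "card (tuples_below A 1 t) = counting A t"
proof -
  have "tuples_below A 1 t = (\<lambda>a. [a]) ` {n \<in> A. real n < t}"
    by (auto simp: tuples_below_def length_Suc_conv)
  then show ?thesis
    by (simp add: counting_eq card_image inj_on_def)
qed

lemma card_tuples_below_Suc:
  "card (tuples_below A (Suc j) t)
     = (\<Sum>a | a \<in> A \<and> real a < t. card (tuples_below A j (t - real a)))"
proof -
  let ?S = "SIGMA a:{a \<in> A. real a < t}. tuples_below A j (t - real a)"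
  have "tuples_below A (Suc j) t = (\<lambda>(a, xs). a # xs) ` ?S"
    by (force simp: tuples_below_def length_Suc_conv image_iff)
  moreover have "inj_on (\<lambda>(a, xs). a # xs) ?S"
    by (auto simp: inj_on_def)
  ultimately show ?thesis
    by (simp add: card_image card_SigmaI finite_nat_below finite_tuples_below)
qed

section \<open>Passing from sums to ordered tuples\<close>

lemma Bh_set_mset_eq:
  assumes B: "Bh_set (2 * k) A"
    and xs: "length xs = k" "set xs \<subseteq> A" and ys: "length ys = k" "set ys \<subseteq> A"
    and eq: "sum_list xs = sum_list ys"
  shows "mset xs = mset ys"
proof -
  have sl: "sum_list (sort zs) = sum_list zs" for zs :: "nat list"
    by (metis mset_sort sum_mset_sum_list)
  \<comment> \<open>Prepending \<open>xs\<close> to both tuples gives \<open>2 * k\<close>-tuples with equal sums.\<close>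
  have "sort (xs @ xs) = sort (xs @ ys)"
    using B unfolding Bh_set_def
    by (rule inj_onD) (use xs ys eq in \<open>auto simp: sl\<close>)
  then have "mset (xs @ xs) = mset (xs @ ys)"
    by (metis mset_sort)
  then show ?thesis by simp
qed

lemma card_tuples_below_le:
  assumes B: "Bh_set (2 * k) A"
  shows "card (tuples_below A k t) \<le> fact k * counting (sumset_fold k A) t"
proof -
  let ?T = "tuples_below A k t" and ?S = "{n \<in> sumset_fold k A. real n < t}"
  have fibre: "card {xs \<in> ?T. sum_list xs = s} \<le> fact k" for s
  proof (cases "\<exists>xs. xs \<in> ?T \<and> sum_list xs = s")
    case True
    then obtain xs where xs: "xs \<in> ?T" "sum_list xs = s" by blast
    have "{ys \<in> ?T. sum_list ys = s} \<subseteq> permutations_of_multiset (mset xs)"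
    proof
      fix ys assume "ys \<in> {ys \<in> ?T. sum_list ys = s}"
      with xs have "mset ys = mset xs"
        by (intro Bh_set_mset_eq[OF B]) (simp_all add: tuples_below_def)
      then show "ys \<in> permutations_of_multiset (mset xs)"
        by (rule permutations_of_multisetI)
    qed
    then have "card {ys \<in> ?T. sum_list ys = s} \<le> card (permutations_of_multiset (mset xs))"
      by (intro card_mono) auto
    also have "\<dots> \<le> fact k"
      using xs by (auto simp: card_permutations_of_multiset tuples_below_def)
    finally show ?thesis .
  next
    case False
    then have "{xs \<in> ?T. sum_list xs = s} = {}" by blast
    then show ?thesis by (metis card.empty zero_le)
  qed
  have "?T = (\<Union>s\<in>?S. {xs \<in> ?T. sum_list xs = s})"
    by (auto simp: tuples_below_def sumset_fold_def)
  then have "card ?T = card (\<Union>s\<in>?S. {xs \<in> ?T. sum_list xs = s})"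
    by (rule arg_cong)
  also have "\<dots> \<le> (\<Sum>s\<in>?S. card {xs \<in> ?T. sum_list xs = s})"
    by (rule card_UN_le[OF finite_nat_below])
  also have "\<dots> \<le> (\<Sum>s\<in>?S. fact k)"
    by (intro sum_mono fibre)
  also have "\<dots> = fact k * counting (sumset_fold k A) t"
    by (simp add: counting_eq)
  finally show ?thesis .
qed

section \<open>Sums of powers over a set with many elements\<close>

lemma has_integral_powr_reflected:
  fixes a T \<beta> :: real
  assumes "\<beta> > 0" "a \<le> T"
  shows "((\<lambda>u. \<beta> * (T - u) powr (\<beta> - 1)) has_integral (T - a) powr \<beta>) {a..T}"
proof -
  have "((\<lambda>u. \<beta> * (T - u) powr (\<beta> - 1)) has_integral
          (- ((T - T) powr \<beta>)) - (- ((T - a) powr \<beta>))) {a..T}"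
  proof (rule fundamental_theorem_of_calculus_interior)
    show "continuous_on {a..T} (\<lambda>u. - ((T - u) powr \<beta>))"
      using assms by (intro continuous_intros continuous_on_powr') auto
    show "((\<lambda>u. - ((T - u) powr \<beta>)) has_vector_derivative \<beta> * (T - u) powr (\<beta> - 1)) (at u)"
      if "u \<in> {a<..<T}" for u
      unfolding has_real_derivative_iff_has_vector_derivative[symmetric]
      using that by (auto intro!: derivative_eq_intros)
  qed (use assms in auto)
  then show ?thesis by simp
qed

lemma has_integral_Beta_interval:
  fixes a b d T :: real
  assumes "a > 0" "b > 0" "d < T"
  shows "((\<lambda>u. (u - d) powr (a - 1) * (T - u) powr (b - 1))
            has_integral (T - d) powr (a + b - 1) * Beta a b) {d..T}"
proof -
  define w where "w = T - d"
  have w: "w > 0" using assms by (simp add: w_def)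
  define f where "f = (\<lambda>t::real. t powr (a - 1) * (1 - t) powr (b - 1))"
  have "(f has_integral Beta a b) (cbox 0 1)"
    using has_integral_Beta_real[OF assms(1,2)] by (simp add: f_def)
  from has_integral_affinity'[OF this, of "1 / w" "- (d / w)"] w
  have "((\<lambda>u. f (u / w - d / w)) has_integral w * Beta a b) (cbox (d / w * w) ((1 + d / w) * w))"
    by (simp add: mult.commute)
  moreover have "d / w * w = d" "(1 + d / w) * w = T"
    using w by (simp_all add: w_def distrib_right)
  ultimately have "((\<lambda>u. f ((u - d) / w)) has_integral w * Beta a b) {d..T}"
    by (simp add: diff_divide_distrib)
  then have "((\<lambda>u. w powr (a + b - 2) * f ((u - d) / w)) has_integral
      w powr (a + b - 2) * (w * Beta a b)) {d..T}"
    by (rule has_integral_mult_right)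
  moreover have "w powr (a + b - 2) * f ((u - d) / w) = (u - d) powr (a - 1) * (T - u) powr (b - 1)"
    if "u \<in> {d..T}" for u
  proof -
    have "1 - (u - d) / w = (T - u) / w"
      using w by (simp add: w_def field_simps)
    then have "f ((u - d) / w) = (u - d) powr (a - 1) * (T - u) powr (b - 1)
        / (w powr (a - 1) * w powr (b - 1))"
      using that w by (simp add: f_def powr_divide)
    also have "w powr (a - 1) * w powr (b - 1) = w powr (a + b - 2)"
      by (simp add: powr_add[symmetric] algebra_simps)
    finally show ?thesis using w by simp
  qed
  moreover have "w powr (a + b - 2) * (w * Beta a b) = w powr (a + b - 1) * Beta a b"
    using w powr_add[of w "a + b - 2" 1] by (simp add: algebra_simps)
  ultimately show ?thesis
    unfolding w_def[symmetric] using has_integral_cong[of "{d..T}"] by (metis (no_types, lifting))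
qed

lemma pos_not_nonpos_Ints: "x > 0 \<Longrightarrow> x \<notin> \<int>\<^sub>\<le>\<^sub>0" for x :: real
  by (auto elim!: nonpos_Ints_cases)

text \<open>
  Partial summation: \<open>(T - a) powr \<beta>\<close> is the integral of \<open>\<beta> * (T - u) powr (\<beta> - 1)\<close> over \<open>u\<close> from
  \<open>a\<close> to \<open>T\<close>, so the sum over \<open>a\<close> is the integral of this density weighted by the number of
  elements of \<open>A\<close> below \<open>u\<close>. Inserting the lower bound for that number gives a Beta integral.
\<close>
lemma sum_powr_ge:
  fixes A :: "nat set" and C d \<alpha> \<beta> T :: real
  assumes C: "C \<ge> 0" and d: "d \<ge> 0" and \<alpha>: "\<alpha> > 0" and \<beta>: "\<beta> > 0" and T: "d < T"
    and bound: "\<And>u. d < u \<Longrightarrow> u \<le> T \<Longrightarrow> real (counting A u) \<ge> C * (u - d) powr \<alpha>"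
  shows "(\<Sum>a | a \<in> A \<and> real a < T. (T - real a) powr \<beta>)
           \<ge> C * (Gamma (1 + \<alpha>) * Gamma (1 + \<beta>) / Gamma (1 + \<alpha> + \<beta>)) * (T - d) powr (\<alpha> + \<beta>)"
proof -
  let ?N = "{a \<in> A. real a < T}"
  define p where "p = (\<lambda>u. \<beta> * (T - u) powr (\<beta> - 1))"
  have p: "p u \<ge> 0" for u using \<beta> by (simp add: p_def)
  have "((\<lambda>u. if u \<in> {real a..T} then p u else 0) has_integral (T - real a) powr \<beta>) {0..T}"
    if "a \<in> ?N" for a
    using has_integral_restrict[of "{real a..T}" "{0..T}" p]
      has_integral_powr_reflected[OF \<beta>, of "real a" T] that
    by (auto simp: p_def)
  then have lhs: "((\<lambda>u. \<Sum>a\<in>?N. if u \<in> {real a..T} then p u else 0) has_integral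
      (\<Sum>a\<in>?N. (T - real a) powr \<beta>)) {0..T}"
    by (intro has_integral_sum finite_nat_below) auto
  have "((\<lambda>u. C * \<beta> * ((u - d) powr (1 + \<alpha> - 1) * (T - u) powr (\<beta> - 1))) has_integral
      C * \<beta> * ((T - d) powr (1 + \<alpha> + \<beta> - 1) * Beta (1 + \<alpha>) \<beta>)) {d..T}"
    by (intro has_integral_mult_right has_integral_Beta_interval) (use \<alpha> \<beta> T in auto)
  then have "((\<lambda>u. C * (u - d) powr \<alpha> * p u) has_integral
      C * \<beta> * ((T - d) powr (\<alpha> + \<beta>) * Beta (1 + \<alpha>) \<beta>)) {d..T}"
    by (simp add: p_def mult_ac)
  then have rhs: "((\<lambda>u. if u \<in> {d..T} then C * (u - d) powr \<alpha> * p u else 0) has_integral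
      C * \<beta> * ((T - d) powr (\<alpha> + \<beta>) * Beta (1 + \<alpha>) \<beta>)) {0..T}"
    using d by (subst has_integral_restrict) auto
  have "C * \<beta> * ((T - d) powr (\<alpha> + \<beta>) * Beta (1 + \<alpha>) \<beta>) \<le> (\<Sum>a\<in>?N. (T - real a) powr \<beta>)"
  proof (rule has_integral_le[OF rhs lhs])
    fix u assume u: "u \<in> {0..T}"
    show "(if u \<in> {d..T} then C * (u - d) powr \<alpha> * p u else 0)
            \<le> (\<Sum>a\<in>?N. if u \<in> {real a..T} then p u else 0)"
    \<comment> \<open>The counting bound is available only for \<open>u > d\<close>; at \<open>u = d\<close> the left side is 0 because \<open>0 powr \<alpha> = 0\<close>.\<close>
    proof (cases "d < u")
      case True
      have "C * (u - d) powr \<alpha> * p u \<le> real (counting A u) * p u"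
        using bound[OF True] u p by (intro mult_right_mono) auto
      also have "\<dots> = (\<Sum>a | a \<in> A \<and> real a < u. p u)"
        by (simp add: counting_eq)
      also have "\<dots> = (\<Sum>a | a \<in> A \<and> real a < u. if u \<in> {real a..T} then p u else 0)"
        using u by (intro sum.cong) auto
      also have "\<dots> \<le> (\<Sum>a\<in>?N. if u \<in> {real a..T} then p u else 0)"
        using u p by (intro sum_mono2 finite_nat_below) auto
      finally show ?thesis using True u by simp
    next
      case False
      then have "(if u \<in> {d..T} then C * (u - d) powr \<alpha> * p u else 0) = 0" by auto
      then show ?thesis using p by (simp add: sum_nonneg)
    qed
  qed
  moreover have "\<beta> * Beta (1 + \<alpha>) \<beta> = Gamma (1 + \<alpha>) * Gamma (1 + \<beta>) / Gamma (1 + \<alpha> + \<beta>)"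
    using Gamma_plus1[of \<beta>] pos_not_nonpos_Ints[OF \<beta>] by (simp add: Beta_def add_ac)
  then have "C * \<beta> * ((T - d) powr (\<alpha> + \<beta>) * Beta (1 + \<alpha>) \<beta>)
     = C * (Gamma (1 + \<alpha>) * Gamma (1 + \<beta>) / Gamma (1 + \<alpha> + \<beta>)) * (T - d) powr (\<alpha> + \<beta>)"
    by (metis mult.assoc mult.commute)
  ultimately show ?thesis by simp
qed

section \<open>The lower bound for the number of tuples\<close>

text \<open>
  The bound on the counting function is required only up to \<open>M\<close>, so that \<open>C\<close> may depend on \<open>M\<close>.
  Each further summand adds another \<open>d\<close> to the shift.
\<close>
lemma card_tuples_below_ge:
  fixes A :: "nat set" and C d \<alpha> M t :: real
  assumes C: "C \<ge> 0" and d: "d \<ge> 0" and \<alpha>: "\<alpha> > 0"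
    and bound: "\<And>u. d < u \<Longrightarrow> u \<le> M \<Longrightarrow> real (counting A u) \<ge> C * (u - d) powr \<alpha>"
    and j: "j \<ge> 1" and t: "real j * d < t" "t \<le> M"
  shows "real (card (tuples_below A j t))
           \<ge> C ^ j * (Gamma (1 + \<alpha>) ^ j / Gamma (1 + real j * \<alpha>)) * (t - real j * d) powr (real j * \<alpha>)"
  using j t
proof (induction j arbitrary: t rule: dec_induct)
  case base
  have "Gamma (1 + \<alpha>) > 0" using \<alpha> by (intro Gamma_real_pos) auto
  then show ?case using bound[of t] base card_tuples_below_1[of A t] by simp
next
  case (step j)
  \<comment> \<open>Only first entries \<open>a < T\<close> leave room for the induction hypothesis at \<open>t - a\<close>.\<close>
  define T where "T = t - real j * d"
  define \<beta> where "\<beta> = real j * \<alpha>"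
  define K where "K = C ^ j * (Gamma (1 + \<alpha>) ^ j / Gamma (1 + \<beta>))"
  have \<beta>: "\<beta> > 0" using step \<alpha> by (simp add: \<beta>_def)
  have G: "Gamma (1 + \<beta>) > 0" "Gamma (1 + \<alpha>) > 0" using \<alpha> \<beta> by (auto intro!: Gamma_real_pos)
  have K: "K \<ge> 0" using G C by (simp add: K_def)
  have dT: "d < T" using step.prems by (simp add: T_def algebra_simps)
  have Tt: "T \<le> t" using d by (simp add: T_def)
  have "C ^ Suc j * (Gamma (1 + \<alpha>) ^ Suc j / Gamma (1 + real (Suc j) * \<alpha>))
          * (t - real (Suc j) * d) powr (real (Suc j) * \<alpha>)
      = K * (C * (Gamma (1 + \<alpha>) * Gamma (1 + \<beta>) / Gamma (1 + \<alpha> + \<beta>)) * (T - d) powr (\<alpha> + \<beta>))"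
    using G by (simp add: K_def T_def \<beta>_def algebra_simps)
  also have "\<dots> \<le> K * (\<Sum>a | a \<in> A \<and> real a < T. (T - real a) powr \<beta>)"
    using step.prems Tt by (intro mult_left_mono sum_powr_ge C d \<alpha> \<beta> dT bound K) auto
  also have "\<dots> = (\<Sum>a | a \<in> A \<and> real a < T. K * (T - real a) powr \<beta>)"
    by (rule sum_distrib_left)
  also have "\<dots> \<le> (\<Sum>a | a \<in> A \<and> real a < T. real (card (tuples_below A j (t - real a))))"
  proof (rule sum_mono)
    fix a assume "a \<in> {a. a \<in> A \<and> real a < T}"
    then have "real j * d < t - real a" "t - real a \<le> M"
      using step.prems by (auto simp: T_def)
    from step.IH[OF this]
    show "K * (T - real a) powr \<beta> \<le> real (card (tuples_below A j (t - real a)))"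
      by (simp add: K_def \<beta>_def T_def algebra_simps)
  qed
  also have "\<dots> \<le> (\<Sum>a | a \<in> A \<and> real a < t. real (card (tuples_below A j (t - real a))))"
    using Tt by (intro sum_mono2 finite_nat_below) auto
  also have "\<dots> = real (card (tuples_below A (Suc j) t))"
    by (simp add: card_tuples_below_Suc)
  finally show ?case .
qed

section \<open>The sumset of a dense \<open>B\<close>-set\<close>

theorem lemma8:
  fixes h k :: nat and A :: "nat set" and \<tau> n0 :: real
  assumes "h = 2 * k" and "h > 0"
    and "Bh_set h A"
    and "\<tau> > 0" and "n0 \<ge> exp 1"
    and "\<And>x::real. x > n0 \<Longrightarrow>
           real (counting A x) \<ge> \<tau> * (x / ln x) powr (1 / real h)"
  shows "Liminf at_top (\<lambda>m::real. ereal (real (counting (sumset_fold k A) m) / sqrt (m / ln m)))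
           \<ge> ereal (2 * \<tau> ^ k * Gamma (1 + 1 / real h) ^ k / (fact k * sqrt pi))"
proof -
  define \<alpha> where "\<alpha> = 1 / real h"
  have \<alpha>: "\<alpha> > 0" and k: "k \<ge> 1" and k\<alpha>: "real k * \<alpha> = 1 / 2"
    using assms(1,2) by (auto simp: \<alpha>_def)
  have n0: "n0 > 1" using assms(5) exp_gt_one[of "1::real"] by linarith
  have B: "Bh_set (2 * k) A" using assms(1,3) by simp
  define L where "L = 2 * \<tau> ^ k * Gamma (1 + \<alpha>) ^ k / (fact k * sqrt pi)"
  define g where "g = (\<lambda>m::real. L * sqrt ((m - real k * n0) / m))"
  have G32: "Gamma (1 + 1 / 2 :: real) = sqrt pi / 2"
    using Gamma_plus1[of "1 / 2 :: real"] pos_not_nonpos_Ints[of "1 / 2"]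
    by (simp add: Gamma_one_half_real add.commute)
  have lower: "g m \<le> real (counting (sumset_fold k A) m) / sqrt (m / ln m)"
    if m: "m > real k * n0" for m
  proof -
    have "n0 \<le> real k * n0" using k n0 by simp
    then have m0: "m > n0" "m > 1" using m n0 by linarith+
    then have lnm: "ln m > 0" by simp
    define C where "C = \<tau> / ln m powr \<alpha>"
    have C: "C \<ge> 0" using assms(4) by (simp add: C_def)
    have bound: "C * (u - n0) powr \<alpha> \<le> real (counting A u)" if u: "n0 < u" "u \<le> m" for u
    proof -
      have "C * (u - n0) powr \<alpha> \<le> C * u powr \<alpha>"
        using u n0 \<alpha> C by (intro mult_left_mono powr_mono2) auto
      also have "\<dots> = \<tau> * (u / ln m) powr \<alpha>"
        using u n0 lnm by (simp add: C_def powr_divide)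
      also have "\<dots> \<le> \<tau> * (u / ln u) powr \<alpha>"
        using u n0 assms(4) \<alpha> by (intro mult_left_mono powr_mono2 divide_left_mono) auto
      also have "\<dots> \<le> real (counting A u)"
        using assms(6)[OF u(1)] by (simp add: \<alpha>_def)
      finally show ?thesis .
    qed
    \<comment> \<open>The power \<open>k * \<alpha> = 1 / 2\<close> of \<open>ln m\<close> is exactly the one in \<open>sqrt (m / ln m)\<close>.\<close>
    have Ck: "C ^ k = \<tau> ^ k / sqrt (ln m)"
    proof -
      have "(ln m powr \<alpha>) ^ k = ln m powr (real k * \<alpha>)"
        using lnm by (simp add: powr_power)
      then show ?thesis using lnm by (simp add: C_def power_divide k\<alpha> powr_half_sqrt)
    qed
    have "fact k * (g m * sqrt (m / ln m)) =
        (\<tau> ^ k / sqrt (ln m)) * (Gamma (1 + \<alpha>) ^ k / (sqrt pi / 2)) * sqrt (m - real k * n0)"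
      using m0 lnm by (simp add: g_def L_def real_sqrt_divide field_simps)
    also have "\<dots> = C ^ k * (Gamma (1 + \<alpha>) ^ k / Gamma (1 + real k * \<alpha>)) * (m - real k * n0) powr (real k * \<alpha>)"
      using m by (simp only: Ck k\<alpha> G32) (simp add: powr_half_sqrt)
    also have "\<dots> \<le> real (card (tuples_below A k m))"
      using n0 m by (intro card_tuples_below_ge[where M = m] C \<alpha> k bound) auto
    also have "\<dots> \<le> real (fact k * counting (sumset_fold k A) m)"
      using card_tuples_below_le[OF B, of m] by linarith
    finally have "fact k * (g m * sqrt (m / ln m)) \<le> fact k * real (counting (sumset_fold k A) m)"
      by simp
    then have "g m * sqrt (m / ln m) \<le> real (counting (sumset_fold k A) m)"
      by simp
    then show ?thesis using m0 lnm by (simp add: pos_le_divide_eq)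
  qed
  have "((\<lambda>m. (real k * n0) / m) \<longlongrightarrow> 0) at_top"
    by (rule tendsto_divide_0[OF tendsto_const filterlim_at_top_imp_at_infinity[OF filterlim_ident]])
  then have "((\<lambda>m. L * sqrt (1 - (real k * n0) / m)) \<longlongrightarrow> L * sqrt (1 - 0)) at_top"
    by (intro tendsto_intros)
  moreover have "\<forall>\<^sub>F m in at_top. L * sqrt (1 - (real k * n0) / m) = g m"
    using eventually_gt_at_top[of 0]
    by eventually_elim (simp add: g_def diff_divide_distrib)
  ultimately have "(g \<longlongrightarrow> L) at_top"
    by (simp add: tendsto_cong)
  then have "Liminf at_top (\<lambda>m. ereal (g m)) = ereal L"
    by (intro lim_imp_Liminf) auto
  moreover have "Liminf at_top (\<lambda>m. ereal (g m))
      \<le> Liminf at_top (\<lambda>m. ereal (real (counting (sumset_fold k A) m) / sqrt (m / ln m)))"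
    by (intro Liminf_mono eventually_mono[OF eventually_gt_at_top[of "real k * n0"]])
       (simp add: lower)
  ultimately show ?thesis by (simp add: L_def \<alpha>_def)
qed

end
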